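(* Let $\mathcal{H}$ be a real Hilbert space, let $\alpha\in[\frac12,1)$, let $T:\mathcal{H}\to\mathcal{H}$ be an $\alpha$-averaged nonexpansive operator, and let $\hat{x}\in\mathrm{Fix}(T)$. For given $x\in\mathcal{H}\setminus\mathrm{Fix}(T)$, define $$\theta^*:=\frac{-\langle Tx-x,\,Tx-\hat{x}\rangle}{\|Tx-x\|^2},\qquad x_{1/2}:=\tfrac12\hat{x}+\tfrac12x.$$ If $Tx\in O(x_{1/2},\|x-x_{1/2}\|)$, then $\theta^*\geq0$ and $\|T^{\theta}x-\hat{x}\|\leq\|Tx-\hat{x}\|$ for all $\theta\in[0,2\theta^*]$. Otherwise, $\theta^*<0$ and $\|T^{\theta}x-\hat{x}\|\leq\|Tx-\hat{x}\|$ for all $\theta\in[2\theta^*,0]$.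
   Context: $\mathcal{I}$ denotes the identity operator on $\mathcal{H}$, and $\mathrm{Fix}(T)=\{x\in\mathcal{H}: Tx=x\}$. An operator $\mathcal{N}:\mathcal{H}\to\mathcal{H}$ is nonexpansive if $\|\mathcal{N}x-\mathcal{N}y\|\le\|x-y\|$ for all $x,y\in\mathcal{H}$. For $\alpha\in(0,1)$, $T$ is $\alpha$-averaged nonexpansive if there is a nonexpansive $\mathcal{N}:\mathcal{H}\to\mathcal{H}$ with $T=(1-\alpha)\mathcal{I}+\alpha\mathcal{N}$. For $\theta\in\mathbb{R}$, $T^{\theta}:=T+\theta(T-\mathcal{I})$. $O(y,r)$ denotes the closed ball with center $y\in\mathcal{H}$ and radius $r$. *)

theory Defs
  imports "HOL-Analysis.Analysis"
begin

definition Fix :: "('a \<Rightarrow> 'a) \<Rightarrow> 'a set" where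
  "Fix T = {x. T x = x}"

definition nonexpansive :: "('a::real_normed_vector \<Rightarrow> 'a) \<Rightarrow> bool" where
  "nonexpansive N \<longleftrightarrow> (\<forall>x y. norm (N x - N y) \<le> norm (x - y))"

definition averaged_nonexpansive :: "real \<Rightarrow> ('a::real_normed_vector \<Rightarrow> 'a) \<Rightarrow> bool" where
  "averaged_nonexpansive \<alpha> T \<longleftrightarrow> 0 < \<alpha> \<and> \<alpha> < 1 \<and>
     (\<exists>N. nonexpansive N \<and> T = (\<lambda>x. (1 - \<alpha>) *\<^sub>R x + \<alpha> *\<^sub>R N x))"

text \<open>The operator written \<open>T\<close> with superscript \<open>\<theta>\<close>, i.e. \<open>T + \<theta> (T - I)\<close>; not an iterate of \<open>T\<close>.\<close>

definition relaxed :: "('a::real_vector \<Rightarrow> 'a) \<Rightarrow> real \<Rightarrow> 'a \<Rightarrow> 'a" where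
  "relaxed T \<theta> = (\<lambda>x. T x + \<theta> *\<^sub>R (T x - x))"

end

theory Submission
  imports Defs
begin

text \<open>
  Write \<open>y = T x\<close> and let \<open>c\<close> be the fixed point. Two facts of plane geometry give the result.

  The ball in question has the segment from \<open>c\<close> to \<open>x\<close> as a diameter. By Thales, \<open>y\<close> lies in it
  exactly when the angle at \<open>y\<close> subtended by that diameter is not acute, that is, when
  \<open>(y - x) \<bullet> (y - c) \<le> 0\<close>, which is the sign condition \<open>\<theta>s \<ge> 0\<close>
  (lemma \<open>mem_cball_diameter_iff\<close>).

  Along the line \<open>y + \<theta> (y - x)\<close> the squared distance to \<open>c\<close> is a quadratic polynomial in \<open>\<theta>\<close> with
  positive leading coefficient and vertex \<open>\<theta>s\<close>. It takes its value at \<open>0\<close> again at the mirror point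
  \<open>2 \<theta>s\<close>, and between these two points it is no larger (lemma \<open>norm_add_scaleR_le_iff\<close>).
  The sign of \<open>\<theta>s\<close> decides which of \<open>0\<close> and \<open>2 \<theta>s\<close> is the left end of that interval.
\<close>

text \<open>
  Thales' theorem: with respect to the centre of the ball, \<open>y\<close> is half the sum and \<open>a\<close> half the
  difference of \<open>y - b\<close> and \<open>y - a\<close>, so by polarization the squared distances of \<open>y\<close> and \<open>a\<close> from
  the centre differ by exactly \<open>(y - a) \<bullet> (y - b)\<close>.
\<close>

lemma mem_cball_diameter_iff:
  fixes a b y :: "'a::real_inner"
  assumes "m = (1/2) *\<^sub>R b + (1/2) *\<^sub>R a"
  shows "y \<in> cball m (norm (a - m)) \<longleftrightarrow> (y - a) \<bullet> (y - b) \<le> 0"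
proof -
  have y: "y - m = (1/2) *\<^sub>R ((y - b) + (y - a))"
   and a: "a - m = (1/2) *\<^sub>R ((y - b) - (y - a))"
    unfolding assms by (simp_all add: algebra_simps flip: scaleR_add_left)
  have "(norm (y - m))\<^sup>2 - (norm (a - m))\<^sup>2 = (y - a) \<bullet> (y - b)"
    unfolding y a power2_norm_eq_inner
    by (simp add: inner_add_left inner_add_right inner_diff_left inner_diff_right
        inner_commute field_simps)
  moreover have "y \<in> cball m (norm (a - m)) \<longleftrightarrow> (norm (y - m))\<^sup>2 \<le> (norm (a - m))\<^sup>2"
    by (simp add: dist_norm norm_minus_commute abs_le_square_iff[symmetric])
  ultimately show ?thesis
    by linarith
qed

text \<open>
  The squared norm of \<open>v + \<theta> u\<close> exceeds that of \<open>v\<close> by \<open>\<theta> (\<theta> - 2 s) \<parallel>u\<parallel>\<^sup>2\<close>, where \<open>s\<close> is the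
  parameter of the point of this line nearest to the origin.
\<close>

lemma norm_add_scaleR_le_iff:
  fixes u v :: "'a::real_inner"
  assumes "u \<noteq> 0" and s: "s = - (u \<bullet> v) / (norm u)\<^sup>2"
  shows "norm (v + \<theta> *\<^sub>R u) \<le> norm v \<longleftrightarrow> \<theta> * (\<theta> - 2 * s) \<le> 0"
proof -
  have pos: "(norm u)\<^sup>2 > 0"
    using assms(1) by simp
  have uv: "u \<bullet> v = - s * (norm u)\<^sup>2"
    unfolding s using pos by simp
  have "(norm (v + \<theta> *\<^sub>R u))\<^sup>2 = (norm v)\<^sup>2 + 2 * \<theta> * (u \<bullet> v) + \<theta>\<^sup>2 * (norm u)\<^sup>2"
    unfolding power2_norm_eq_inner
    by (simp add: inner_add_left inner_add_right inner_commute power2_eq_square algebra_simps)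
  also have "\<dots> = (norm v)\<^sup>2 + \<theta> * (\<theta> - 2 * s) * (norm u)\<^sup>2"
    unfolding uv by (simp add: power2_eq_square algebra_simps)
  finally have "(norm (v + \<theta> *\<^sub>R u))\<^sup>2 \<le> (norm v)\<^sup>2 \<longleftrightarrow> \<theta> * (\<theta> - 2 * s) * (norm u)\<^sup>2 \<le> 0"
    by simp
  also have "\<dots> \<longleftrightarrow> \<theta> * (\<theta> - 2 * s) \<le> 0"
    using pos by (simp add: mult_le_0_iff)
  finally show ?thesis
    by (simp add: abs_le_square_iff[symmetric])
qed

theorem theorem3p4:
  fixes T :: "'a::{real_inner, complete_space} \<Rightarrow> 'a"
    and \<alpha> \<theta>s :: real
    and x xhat xhalf :: 'a
  assumes "\<alpha> \<in> {1/2..<1}"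
    and "averaged_nonexpansive \<alpha> T"
    and "xhat \<in> Fix T"
    and "x \<notin> Fix T"
    and "\<theta>s = - ((T x - x) \<bullet> (T x - xhat)) / (norm (T x - x))\<^sup>2"
    and "xhalf = (1/2) *\<^sub>R xhat + (1/2) *\<^sub>R x"
  shows "(T x \<in> cball xhalf (norm (x - xhalf)) \<longrightarrow>
            \<theta>s \<ge> 0 \<and>
            (\<forall>\<theta>\<in>{0..2 * \<theta>s}. norm (relaxed T \<theta> x - xhat) \<le> norm (T x - xhat))) \<and>
         (T x \<notin> cball xhalf (norm (x - xhalf)) \<longrightarrow>
            \<theta>s < 0 \<and>
            (\<forall>\<theta>\<in>{2 * \<theta>s..0}. norm (relaxed T \<theta> x - xhat) \<le> norm (T x - xhat)))"
proof -
  define u where "u = T x - x"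
  define v where "v = T x - xhat"
  have u: "u \<noteq> 0"
    using assms(4) by (simp add: u_def Fix_def)
  have s: "\<theta>s = - (u \<bullet> v) / (norm u)\<^sup>2"
    using assms(5) by (simp add: u_def v_def)
  have ball: "T x \<in> cball xhalf (norm (x - xhalf)) \<longleftrightarrow> \<theta>s \<ge> 0"
    unfolding mem_cball_diameter_iff[OF assms(6)] s using u
    by (simp add: u_def v_def divide_le_0_iff)
  have "relaxed T \<theta> x - xhat = v + \<theta> *\<^sub>R u" for \<theta>
    by (simp add: relaxed_def u_def v_def)
  then have closer: "norm (relaxed T \<theta> x - xhat) \<le> norm (T x - xhat) \<longleftrightarrow> \<theta> * (\<theta> - 2 * \<theta>s) \<le> 0" for \<theta>
    using norm_add_scaleR_le_iff[OF u s, of \<theta>] unfolding v_def by metis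
  show ?thesis
    unfolding ball closer by (auto simp: mult_le_0_iff)
qed

end
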